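(* Let $\rho>2H$, and let $(x_1^k,\dots,x_n^k,z^k,y^k)_{k\ge0}$ be a bounded sequence generated by the ADMM iteration described in the context. Define $$u_k=\min_{0\le l\le k}\Big(\|z^{l+1}-z^l\|_2^2+\sum_{i=1}^n\|A_i(x_i^{l+1}-x_i^l)\|_2^2\Big).$$ Then $u_k=o(1/k)$ as $k\to\infty$.
   Context: Problem: minimize $F(x_1,\dots,x_n,z)=f(x_1,\dots,x_n)+h(z)$ over $x_i\in\mathbb{R}^{p_i}$ ($i=1,\dots,n$), $z\in\mathbb{R}^q$, subject to $\sum_{i=1}^n A_ix_i-z=0$, where $A_i\in\mathbb{R}^{q\times p_i}$ are matrices; $f:\mathbb{R}^p\to\mathbb{R}\cup\{\infty\}$ ($p=\sum_i p_i$) is proper, continuous, possibly nonsmooth, and multi-convex (i.e. convex in each $x_i$ when all the other variables are fixed); $h:\mathbb{R}^q\to\mathbb{R}$ is proper, differentiable and convex. Standing assumptions: the objective of the problem is bounded from below on the feasible set; $h$ is Lipschitz differentiable with constant $H\ge 0$, i.e. $\|\nabla h(z')-\nabla h(z'')\|\le H\|z'-z''\|$ for all $z',z''\in\mathbb{R}^q$. Augmented Lagrangian, for a penalty parameter $\rho>0$ and dual variable $y\in\mathbb{R}^q$: $L_\rho(x_1,\dots,x_n,z,y)=f(x_1,\dots,x_n)+h(z)+y^T(\sum_{i=1}^nA_ix_i-z)+\frac{\rho}{2}\|\sum_{i=1}^nA_ix_i-z\|_2^2$. ADMM iteration (run indefinitely, from an initial point $(x_1^0,\dots,x_n^0,z^0,y^0)$):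 for $k=0,1,2,\dots$, first for $i=1,\dots,n$ in order, $x_i^{k+1}$ is a minimizer over $x_i$ of $L_\rho(x_1^{k+1},\dots,x_{i-1}^{k+1},x_i,x_{i+1}^k,\dots,x_n^k,z^k,y^k)$; then $z^{k+1}$ is a minimizer over $z$ of $L_\rho(x_1^{k+1},\dots,x_n^{k+1},z,y^k)$; then $r^{k+1}=\sum_{i=1}^nA_ix_i^{k+1}-z^{k+1}$ and $y^{k+1}=y^k+\rho r^{k+1}$. Each subproblem is assumed to be solvable (the minimum is attained, with finite value). *)

theory Defs
  imports "HOL-Analysis.Analysis" "HOL-Library.Landau_Symbols"
begin

text \<open>
  The blocks may have different dimensions, so the product of the spaces \<open>\<real>^p\<^sub>i\<close> is represented
  as the single space \<open>real ^ 'p\<close> together with a map \<open>b\<close> that sends each coordinate to the number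
  of its block: \<open>x\<^sub>i\<close> consists of the coordinates \<open>x $ j\<close> with \<open>b j = i\<close>, and
  \<open>p\<^sub>i = card {j. b j = i}\<close>. Likewise \<open>A :: real ^ 'p ^ 'q\<close> is the block row
  \<open>[A\<^sub>1 \<dots> A\<^sub>n]\<close>, where \<open>A\<^sub>i\<close> is formed by the columns \<open>j\<close> with \<open>b j = i\<close>.
\<close>

definition block_decomposition :: "nat \<Rightarrow> ('p::finite \<Rightarrow> nat) \<Rightarrow> bool" where
  "block_decomposition n b \<longleftrightarrow> range b = {1..n}"

text \<open>The product \<open>A\<^sub>i x\<^sub>i\<close>.\<close>

definition block_mult ::
  "real ^ 'p ^ 'q \<Rightarrow> ('p::finite \<Rightarrow> nat) \<Rightarrow> nat \<Rightarrow> real ^ 'p \<Rightarrow> real ^ 'q" where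
  "block_mult A b i x = (\<Sum>j | b j = i. x $ j *\<^sub>R column j A)"

lemma sum_block_mult:
  assumes "block_decomposition n b"
  shows "(\<Sum>i=1..n. block_mult A b i x) = A *v x"
proof -
  have "(\<Sum>i=1..n. block_mult A b i x)
      = (\<Sum>i=1..n. \<Sum>j | j \<in> UNIV \<and> b j = i. x $ j *\<^sub>R column j A)"
    by (simp add: block_mult_def)
  also have "\<dots> = (\<Sum>j\<in>UNIV. x $ j *\<^sub>R column j A)"
    using assms by (intro sum.group) (auto simp: block_decomposition_def)
  also have "\<dots> = A *v x"
    by (simp add: matrix_mult_sum scalar_mult_eq_scaleR)
  finally show ?thesis .
qed

text \<open>
  The point \<open>(u\<^sub>1, \<dots>, u\<^sub>i\<^sub>-\<^sub>1, v\<^sub>i, w\<^sub>i\<^sub>+\<^sub>1, \<dots>, w\<^sub>n)\<close>; only the \<open>i\<close>-th block of \<open>v\<close> is used, so letting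
  \<open>v\<close> range over the whole space amounts to letting \<open>v\<^sub>i\<close> range over \<open>\<real>^p\<^sub>i\<close>.
\<close>

definition splice_blocks ::
  "('p::finite \<Rightarrow> nat) \<Rightarrow> nat \<Rightarrow> real ^ 'p \<Rightarrow> real ^ 'p \<Rightarrow> real ^ 'p \<Rightarrow> real ^ 'p" where
  "splice_blocks b i u v w =
     (\<chi> j. if b j < i then u $ j else if b j = i then v $ j else w $ j)"

definition proper :: "('a \<Rightarrow> ereal) \<Rightarrow> bool" where
  "proper f \<longleftrightarrow> (\<forall>x. f x \<noteq> -\<infinity>) \<and> (\<exists>x. f x \<noteq> \<infinity>)"

definition convex_ereal :: "('a::real_vector \<Rightarrow> ereal) \<Rightarrow> bool" where
  "convex_ereal f \<longleftrightarrow>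
     (\<forall>x y. \<forall>t\<in>{0<..<1}. f ((1 - t) *\<^sub>R x + t *\<^sub>R y) \<le> ereal (1 - t) * f x + ereal t * f y)"

definition multi_convex :: "nat \<Rightarrow> ('p::finite \<Rightarrow> nat) \<Rightarrow> (real ^ 'p \<Rightarrow> ereal) \<Rightarrow> bool" where
  "multi_convex n b f \<longleftrightarrow>
     (\<forall>i\<in>{1..n}. \<forall>x. convex_ereal (\<lambda>v. f (splice_blocks b i x v x)))"

definition residual ::
  "nat \<Rightarrow> ('p::finite \<Rightarrow> nat) \<Rightarrow> real ^ 'p ^ 'q \<Rightarrow> real ^ 'p \<Rightarrow> real ^ 'q \<Rightarrow> real ^ 'q" where
  "residual n b A x z = (\<Sum>i=1..n. block_mult A b i x) - z"

definition bounded_below_on_feasible ::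
  "nat \<Rightarrow> ('p::finite \<Rightarrow> nat) \<Rightarrow> real ^ 'p ^ 'q \<Rightarrow> (real ^ 'p \<Rightarrow> ereal) \<Rightarrow> (real ^ 'q \<Rightarrow> real) \<Rightarrow> bool"
  where
  "bounded_below_on_feasible n b A f h \<longleftrightarrow>
     (\<exists>m::real. \<forall>x z. residual n b A x z = 0 \<longrightarrow> ereal m \<le> f x + ereal (h z))"

definition aug_lagrangian ::
  "nat \<Rightarrow> ('p::finite \<Rightarrow> nat) \<Rightarrow> real ^ 'p ^ 'q \<Rightarrow> (real ^ 'p \<Rightarrow> ereal) \<Rightarrow> (real ^ 'q \<Rightarrow> real) \<Rightarrow> real
    \<Rightarrow> real ^ 'p \<Rightarrow> real ^ 'q \<Rightarrow> real ^ 'q \<Rightarrow> ereal" where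
  "aug_lagrangian n b A f h \<rho> x z y =
     f x + ereal (h z + y \<bullet> residual n b A x z + \<rho> / 2 * (norm (residual n b A x z))\<^sup>2)"

definition finite_minimizer :: "('a \<Rightarrow> ereal) \<Rightarrow> 'a \<Rightarrow> bool" where
  "finite_minimizer \<phi> u \<longleftrightarrow> \<bar>\<phi> u\<bar> \<noteq> \<infinity> \<and> (\<forall>v. \<phi> u \<le> \<phi> v)"

definition admm_sequence ::
  "nat \<Rightarrow> ('p::finite \<Rightarrow> nat) \<Rightarrow> real ^ 'p ^ 'q \<Rightarrow> (real ^ 'p \<Rightarrow> ereal) \<Rightarrow> (real ^ 'q \<Rightarrow> real) \<Rightarrow> real
    \<Rightarrow> (nat \<Rightarrow> real ^ 'p) \<Rightarrow> (nat \<Rightarrow> real ^ 'q) \<Rightarrow> (nat \<Rightarrow> real ^ 'q) \<Rightarrow> bool" where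
  "admm_sequence n b A f h \<rho> x z y \<longleftrightarrow>
     (\<forall>k.
        (\<forall>i\<in>{1..n}. finite_minimizer
           (\<lambda>v. aug_lagrangian n b A f h \<rho> (splice_blocks b i (x (Suc k)) v (x k)) (z k) (y k))
           (x (Suc k))) \<and>
        finite_minimizer (\<lambda>w. aug_lagrangian n b A f h \<rho> (x (Suc k)) w (y k)) (z (Suc k)) \<and>
        y (Suc k) = y k + \<rho> *\<^sub>R residual n b A (x (Suc k)) (z (Suc k)))"

end

theory Submission
  imports Defs
begin

text \<open>
  The augmented Lagrangian \<open>E k = L (x k) (z k) (y k)\<close> is a Lyapunov function of the iteration.
  Each primal step minimizes a convex function plus the penalty \<open>\<rho> / 2\<close> times the squared norm of an
  affine residual, so it lowers the Lagrangian by at least \<open>\<rho> / 2\<close> times the squared change of that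
  residual (\<open>minimizer_quadratic_growth\<close>): \<open>\<rho> / 2 * (norm (A\<^sub>i dx\<^sub>i))\<^sup>2\<close> for a block and
  \<open>\<rho> / 2 * (norm dz)\<^sup>2\<close> for \<open>z\<close>. The dual step raises it by \<open>(norm dy)\<^sup>2 / \<rho>\<close>. The optimality
  condition of the \<open>z\<close>-step is \<open>grad_h (z k) = y k\<close> (\<open>slack_step_optimality\<close>), so the Lipschitz
  condition gives \<open>norm dy \<le> H * norm dz\<close>, and the rise is at most \<open>H\<^sup>2 / \<rho> * (norm dz)\<^sup>2\<close>. Since
  \<open>\<rho> > 2 * H\<close>, the constant \<open>c = \<rho> / 2 - H\<^sup>2 / \<rho>\<close> is positive, and one iteration lowers \<open>E\<close> by at
  least \<open>c\<close> times the quantity whose running minimum is \<open>u\<close>.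

  The identity \<open>y k = grad_h (z k)\<close> also bounds \<open>E\<close> from below: replacing \<open>z\<close> by the feasible
  \<open>A x\<close> changes \<open>h\<close> by at most the linear and the quadratic term of the Lagrangian, so \<open>E\<close> dominates
  the objective at a feasible point (\<open>aug_lagrangian_lower_bound\<close>). Hence the decreases are summable,
  and the running minimum of a nonnegative summable sequence is \<open>o(1 / k)\<close>, because \<open>k / 2\<close> times
  the minimum is at most the sum over the last half of the indices (\<open>running_Min_smallo\<close>).

  The identity \<open>y k = grad_h (z k)\<close> and the finiteness of \<open>E k\<close> both come from a completed
  iteration; they can fail at \<open>k = 0\<close>, so all estimates start at \<open>k = 1\<close>.
\<close>

section \<open>Running minima of summable sequences\<close>

text \<open>
  Averaging over all \<open>k\<close> indices would give only \<open>O(1 / k)\<close>. The sum over the indices from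
  \<open>k div 2\<close> to \<open>k\<close> is a difference of two partial sums with the same limit, so it tends to \<open>0\<close>,
  yet it still has at least \<open>k / 2\<close> terms, each at least \<open>u k\<close>.
\<close>

lemma running_Min_smallo:
  fixes a u :: "nat \<Rightarrow> real"
  assumes "summable a" and nonneg: "\<And>l. a l \<ge> 0"
    and u: "\<And>k. u k = Min (a ` {0..k})"
  shows "u \<in> o(\<lambda>k. 1 / real k)"
proof -
  define S where "S k = (\<Sum>l<k. a l)" for k
  have lim: "S \<longlonglongrightarrow> suminf a"
    unfolding S_def using summable_LIMSEQ[OF assms(1)] .
  have u_le: "u k \<le> a l" if "l \<le> k" for k l
    unfolding u using that by (intro Min_le) auto
  have u_nonneg: "0 \<le> u k" for k
    unfolding u using nonneg by (subst Min_ge_iff) auto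
  have bound: "real k * u k \<le> 2 * (S k - S (k div 2))" for k
  proof -
    have "real k / 2 * u k \<le> real (k - k div 2) * u k"
      by (intro mult_right_mono u_nonneg) linarith
    also have "\<dots> = (\<Sum>l\<in>{k div 2..<k}. u k)"
      by simp
    also have "\<dots> \<le> (\<Sum>l\<in>{k div 2..<k}. a l)"
      by (intro sum_mono u_le) auto
    also have "\<dots> = S k - S (k div 2)"
      unfolding S_def using sum_diff_nat_ivl[of 0 "k div 2" k a]
      by (simp add: atLeast0LessThan)
    finally show ?thesis by simp
  qed
  have "filterlim (\<lambda>k::nat. k div 2) sequentially sequentially"
    by (rule filterlim_at_top_div_const_nat) simp
  then have "(\<lambda>k. S (k div 2)) \<longlonglongrightarrow> suminf a"
    by (rule filterlim_compose[OF lim])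
  then have "(\<lambda>k. 2 * (S k - S (k div 2))) \<longlonglongrightarrow> 2 * (suminf a - suminf a)"
    by (intro tendsto_intros lim)
  then have gap: "(\<lambda>k. 2 * (S k - S (k div 2))) \<longlonglongrightarrow> 0"
    by simp
  have "(\<lambda>k. real k * u k) \<longlonglongrightarrow> 0"
    by (rule tendsto_sandwich[OF _ _ tendsto_const gap])
       (use bound u_nonneg in \<open>auto intro!: always_eventually mult_nonneg_nonneg\<close>)
  then have "(\<lambda>k. u k / (1 / real k)) \<longlonglongrightarrow> 0"
    by (simp add: mult.commute)
  then show ?thesis
    by (intro smalloI_tendsto) (auto intro: eventually_mono[OF eventually_gt_at_top[of 0]])
qed

lemma summable_of_descent:
  fixes a E :: "nat \<Rightarrow> real"
  assumes nonneg: "\<And>k. a k \<ge> 0" and "c > 0"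
    and descent: "\<And>k. k \<ge> 1 \<Longrightarrow> E (Suc k) + c * a k \<le> E k"
    and lower: "\<And>k. k \<ge> 1 \<Longrightarrow> m \<le> E k"
  shows "summable a"
proof -
  have partial: "E (Suc N) + c * (\<Sum>k<N. a (Suc k)) \<le> E 1" for N
  proof (induction N)
    case (Suc N)
    then show ?case
      using descent[of "Suc N"] by (simp add: algebra_simps)
  qed simp
  have "(\<Sum>k<N. a (Suc k)) \<le> (E 1 - m) / c" for N
    using partial[of N] lower[of "Suc N"] \<open>c > 0\<close> by (simp add: field_simps)
  then have "summable (\<lambda>k. a (Suc k))"
    by (intro summableI_nonneg_bounded[of _ "(E 1 - m) / c"]) (auto simp: nonneg)
  then show ?thesis
    by (simp add: summable_Suc_iff)
qed

section \<open>Convex functions\<close>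

lemma norm_convex_combination:
  fixes p q :: "'a::real_inner"
  shows "(norm ((1 - t) *\<^sub>R p + t *\<^sub>R q))\<^sup>2
    = (1 - t) * (norm p)\<^sup>2 + t * (norm q)\<^sup>2 - t * (1 - t) * (norm (q - p))\<^sup>2"
  unfolding power2_norm_eq_inner
  by (simp add: algebra_simps inner_commute power2_eq_square)

text \<open>
  Along the segment from \<open>u\<close> to \<open>v\<close> the quadratic term is strongly convex with respect to \<open>R\<close>, with
  excess \<open>t * (1 - t) * D\<close>. Comparing \<open>\<phi> u\<close> with the value at parameter \<open>t\<close>, dividing by \<open>t\<close> and
  letting \<open>t\<close> tend to \<open>0\<close> gives the claim without any subgradient, so \<open>g\<close> may be nonsmooth and
  take the value \<open>\<infinity>\<close>. The growth is measured in \<open>R\<close> only: minimizers need not be unique when \<open>R\<close> is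
  not injective.
\<close>

lemma minimizer_quadratic_growth:
  fixes g :: "'a::real_vector \<Rightarrow> ereal" and R :: "'a \<Rightarrow> 'b::real_inner"
    and c \<rho> :: real and y :: 'b
  defines "\<phi> \<equiv> \<lambda>v. g v + ereal (c + y \<bullet> R v + \<rho> / 2 * (norm (R v))\<^sup>2)"
  assumes "convex_ereal g"
    and affine: "\<And>t. R ((1 - t) *\<^sub>R u + t *\<^sub>R v) = (1 - t) *\<^sub>R R u + t *\<^sub>R R v"
    and min: "finite_minimizer \<phi> u"
  shows "\<phi> u + ereal (\<rho> / 2 * (norm (R v - R u))\<^sup>2) \<le> \<phi> v"
proof (cases "g v = \<infinity>")
  case True
  then show ?thesis by (simp add: \<phi>_def)
next
  case False
  define D where "D = \<rho> / 2 * (norm (R v - R u))\<^sup>2"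
  define q where "q w = c + y \<bullet> R w + \<rho> / 2 * (norm (R w))\<^sup>2" for w
  have \<phi>: "\<phi> w = g w + ereal (q w)" for w
    by (simp add: \<phi>_def q_def)
  have fin: "\<bar>\<phi> u\<bar> \<noteq> \<infinity>" and le: "\<phi> u \<le> \<phi> w" for w
    using min by (auto simp: finite_minimizer_def)
  obtain gu where gu: "g u = ereal gu"
    using fin by (cases "g u") (auto simp: \<phi>)
  obtain gv where gv: "g v = ereal gv"
    using False le[of v] by (cases "g v") (auto simp: \<phi> gu)
  have q_comb: "q ((1 - t) *\<^sub>R u + t *\<^sub>R v) = (1 - t) * q u + t * q v - t * (1 - t) * D" for t
    unfolding q_def D_def affine norm_convex_combination
    by (simp only: inner_add_right inner_scaleR_right) (simp add: field_simps)
  have step: "gu + q u + (1 - t) * D \<le> gv + q v" if t: "t \<in> {0<..<1}" for t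
  proof -
    let ?w = "(1 - t) *\<^sub>R u + t *\<^sub>R v"
    have gw: "g ?w \<le> ereal ((1 - t) * gu + t * gv)"
      using \<open>convex_ereal g\<close> t unfolding convex_ereal_def by (metis gu gv plus_ereal.simps(1) times_ereal.simps(1))
    have "ereal (gu + q u) \<le> g ?w + ereal (q ?w)"
      using le[of ?w] by (simp add: \<phi> gu)
    also have "\<dots> \<le> ereal ((1 - t) * gu + t * gv) + ereal (q ?w)"
      by (intro add_right_mono gw)
    finally have "gu + q u \<le> (1 - t) * gu + t * gv + q ?w" by simp
    then have "t * (gu + q u + (1 - t) * D) \<le> t * (gv + q v)"
      unfolding q_comb by (simp add: algebra_simps)
    then show ?thesis using t by simp
  qed
  have "((\<lambda>t. gu + q u + (1 - t) * D) \<longlongrightarrow> gu + q u + (1 - 0) * D) (at_right (0::real))"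
    by (intro tendsto_intros)
  moreover have "\<forall>\<^sub>F t in at_right 0. gu + q u + (1 - t) * D \<le> gv + q v"
    using eventually_at_right_real[of 0 1] by (rule eventually_mono) (auto intro: step)
  ultimately have "gu + q u + (1 - 0) * D \<le> gv + q v"
    by (intro tendsto_upperbound) auto
  then show ?thesis
    by (simp add: \<phi> gu gv D_def)
qed

text \<open>
  Restricting \<open>h\<close> to the line through \<open>a\<close> and \<open>w\<close> reduces this to the one-dimensional inequality.
\<close>

lemma convex_above_tangent:
  fixes h :: "'a::real_inner \<Rightarrow> real"
  assumes "convex_on UNIV h" and "GDERIV h a :> D"
  shows "h a + (w - a) \<bullet> D \<le> h w"
proof -
  define \<gamma> where "\<gamma> t = a + t *\<^sub>R (w - a)" for t :: real
  have \<gamma>: "\<gamma> ((1 - t) * r + t * s) = (1 - t) *\<^sub>R \<gamma> r + t *\<^sub>R \<gamma> s" for t r s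
    by (simp add: \<gamma>_def algebra_simps)
  have "convex_on UNIV (h \<circ> \<gamma>)"
    by (intro convex_onI) (use convex_onD[OF assms(1)] in \<open>auto simp: \<gamma>\<close>)
  moreover have "(h \<circ> \<gamma> has_real_derivative (w - a) \<bullet> D) (at 0 within UNIV)"
  proof -
    have "(\<gamma> has_derivative (\<lambda>t. t *\<^sub>R (w - a))) (at 0)"
      unfolding \<gamma>_def by (auto intro!: derivative_eq_intros)
    moreover have "(h has_derivative (\<lambda>d. d \<bullet> D)) (at (\<gamma> 0))"
      using assms(2) by (simp add: gderiv_def \<gamma>_def)
    ultimately have "(h \<circ> \<gamma> has_derivative (\<lambda>d. d \<bullet> D) \<circ> (\<lambda>t. t *\<^sub>R (w - a))) (at 0)"
      by (rule diff_chain_at)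
    then show ?thesis
      by (simp add: has_field_derivative_def o_def mult.commute[of _ "(w - a) \<bullet> D"])
  qed
  ultimately have "(w - a) \<bullet> D * (1 - 0) \<le> (h \<circ> \<gamma>) 1 - (h \<circ> \<gamma>) 0"
    by (intro convex_on_imp_above_tangent[where A = UNIV]) (simp_all del: o_apply)
  then show ?thesis by (simp add: \<gamma>_def)
qed

lemma convex_ereal_real:
  "convex_on UNIV h \<Longrightarrow> convex_ereal (\<lambda>w. ereal (h w))"
  by (auto simp: convex_ereal_def intro!: convex_onD)

text \<open>
  The tangent at \<open>a\<close>, rather than the one at \<open>w\<close>, bounds \<open>h a\<close> from above; moving the gradient back
  to \<open>w\<close> costs the Lipschitz term. Integrating the gradient along the segment would improve the
  constant \<open>H\<close> to \<open>H / 2\<close>, but \<open>H \<le> \<rho> / 2\<close> makes this form sufficient for the lower bound on the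
  Lagrangian.
\<close>

lemma convex_lipschitz_gradient_upper_bound:
  fixes h :: "'a::real_inner \<Rightarrow> real"
  assumes "convex_on UNIV h" and "\<And>w. GDERIV h w :> grad_h w" and "H-lipschitz_on UNIV grad_h"
  shows "h a \<le> h w + grad_h w \<bullet> (a - w) + H * (norm (a - w))\<^sup>2"
proof -
  have "h a \<le> h w + (a - w) \<bullet> grad_h a"
    using convex_above_tangent[OF assms(1,2), of a w] by (simp add: inner_diff_left)
  also have "\<dots> = h w + grad_h w \<bullet> (a - w) + (a - w) \<bullet> (grad_h a - grad_h w)"
    by (simp add: inner_diff_right inner_commute)
  also have "(a - w) \<bullet> (grad_h a - grad_h w) \<le> norm (a - w) * norm (grad_h a - grad_h w)"
    by (rule norm_cauchy_schwarz)
  also have "norm (grad_h a - grad_h w) \<le> H * norm (a - w)"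
    using lipschitz_onD[OF assms(3), of a w] by (simp add: dist_norm)
  finally show ?thesis
    by (simp add: power2_eq_square mult_left_mono mult.left_commute)
qed

section \<open>The three steps of an iteration\<close>

lemma residual_eq:
  "block_decomposition n b \<Longrightarrow> residual n b A x z = A *v x - z"
  unfolding residual_def by (subst sum_block_mult) simp_all

text \<open>
  With all other blocks equal, the residual changes only through \<open>A\<^sub>i\<close>. This turns the quadratic
  growth in the residual into growth in the product \<open>A\<^sub>i x\<^sub>i\<close>.
\<close>

lemma splice_blocks_diff:
  "A *v splice_blocks b i p v w - A *v splice_blocks b i p v' w = block_mult A b i (v - v')"
proof -
  have "splice_blocks b i p v w - splice_blocks b i p v' w
      = (\<chi> j. if b j = i then (v - v') $ j else 0)"
    by (simp add: splice_blocks_def vec_eq_iff)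
  then have "A *v splice_blocks b i p v w - A *v splice_blocks b i p v' w
      = A *v (\<chi> j. if b j = i then (v - v') $ j else 0)"
    by (metis matrix_vector_mult_diff_distrib)
  also have "\<dots> = (\<Sum>j\<in>UNIV. if b j = i then (v - v') $ j *\<^sub>R column j A else 0)"
    unfolding matrix_mult_sum scalar_mult_eq_scaleR by (intro sum.cong) auto
  also have "\<dots> = block_mult A b i (v - v')"
    unfolding block_mult_def by (simp add: sum.If_cases)
  finally show ?thesis .
qed

lemma splice_blocks_affine:
  "splice_blocks b i p ((1 - t) *\<^sub>R u + t *\<^sub>R v) w
    = (1 - t) *\<^sub>R splice_blocks b i p u w + t *\<^sub>R splice_blocks b i p v w"
  by (simp add: splice_blocks_def vec_eq_iff algebra_simps)

lemma affine_combination_diff: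
  fixes p q r :: "'a::real_vector"
  shows "(1 - t) *\<^sub>R p + t *\<^sub>R q - r = (1 - t) *\<^sub>R (p - r) + t *\<^sub>R (q - r)"
  by (simp add: algebra_simps)

lemma block_step_descent:
  assumes "block_decomposition n b" and "multi_convex n b f" and i: "i \<in> {1..n}"
    and min: "finite_minimizer
      (\<lambda>v. aug_lagrangian n b A f h \<rho> (splice_blocks b i p v w) z y) u"
  shows "aug_lagrangian n b A f h \<rho> (splice_blocks b i p u w) z y
      + ereal (\<rho> / 2 * (norm (block_mult A b i (u - v)))\<^sup>2)
    \<le> aug_lagrangian n b A f h \<rho> (splice_blocks b i p v w) z y"
proof -
  define g where "g v = f (splice_blocks b i p v w)" for v
  define R where "R v = residual n b A (splice_blocks b i p v w) z" for v
  \<comment> \<open>Multi-convexity varies one block of a single base point; \<open>s\<close> is the base point that has the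
    blocks of \<open>p\<close> before \<open>i\<close> and those of \<open>w\<close> after \<open>i\<close>.\<close>
  define s where "s = splice_blocks b i p p w"
  have s: "splice_blocks b i s v s = splice_blocks b i p v w" for v
    by (simp add: splice_blocks_def vec_eq_iff s_def)
  have "convex_ereal (\<lambda>v. f (splice_blocks b i s v s))"
    using \<open>multi_convex n b f\<close> i by (simp add: multi_convex_def)
  then have "convex_ereal g"
    unfolding s g_def .
  moreover have "R ((1 - t) *\<^sub>R u + t *\<^sub>R v) = (1 - t) *\<^sub>R R u + t *\<^sub>R R v" for t
    unfolding R_def residual_eq[OF assms(1)] splice_blocks_affine
      matrix_vector_right_distrib matrix_vector_mult_scaleR
    by (rule affine_combination_diff)
  moreover have "finite_minimizer
      (\<lambda>v. g v + ereal (h z + y \<bullet> R v + \<rho> / 2 * (norm (R v))\<^sup>2)) u"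
    using min by (simp add: aug_lagrangian_def g_def R_def)
  ultimately have "g u + ereal (h z + y \<bullet> R u + \<rho> / 2 * (norm (R u))\<^sup>2)
      + ereal (\<rho> / 2 * (norm (R v - R u))\<^sup>2)
    \<le> g v + ereal (h z + y \<bullet> R v + \<rho> / 2 * (norm (R v))\<^sup>2)"
    by (rule minimizer_quadratic_growth)
  moreover have "norm (R v - R u) = norm (block_mult A b i (u - v))"
    using splice_blocks_diff[of A b i p u w v]
    by (simp add: R_def residual_eq[OF assms(1)] norm_minus_commute)
  ultimately show ?thesis
    by (simp add: aug_lagrangian_def g_def R_def)
qed

text \<open>
  The descents of the single block steps telescope along the points that have the first \<open>m\<close> blocks of
  \<open>x'\<close> and the other blocks of \<open>x\<close>. The values are extended reals because nothing forces \<open>f x\<close> to be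
  finite.
\<close>

lemma block_sweep_descent:
  assumes "block_decomposition n b" and "multi_convex n b f"
    and min: "\<And>i. i \<in> {1..n} \<Longrightarrow> finite_minimizer
      (\<lambda>v. aug_lagrangian n b A f h \<rho> (splice_blocks b i x' v x) z y) x'"
  shows "aug_lagrangian n b A f h \<rho> x' z y
      + ereal (\<rho> / 2 * (\<Sum>i=1..n. (norm (block_mult A b i (x' - x)))\<^sup>2))
    \<le> aug_lagrangian n b A f h \<rho> x z y"
proof -
  let ?L = "\<lambda>x. aug_lagrangian n b A f h \<rho> x z y"
  let ?d = "\<lambda>i. \<rho> / 2 * (norm (block_mult A b i (x' - x)))\<^sup>2"
  \<comment> \<open>Blocks are numbered from \<open>1\<close>, so \<open>s i\<close> has exactly the first \<open>i\<close> blocks of \<open>x'\<close>.\<close>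
  define s where "s i = splice_blocks b (Suc i) x' x x" for i
  have b: "b j \<in> {1..n}" for j
    using assms(1) by (auto simp: block_decomposition_def)
  have b': "b j \<noteq> 0" "b j \<le> n" for j
    using b[of j] by auto
  have "s 0 = x" "s n = x'"
    by (simp_all add: b' s_def splice_blocks_def vec_eq_iff less_Suc_eq_le)
  have before: "splice_blocks b (Suc i) x' x x = s i"
    and after: "splice_blocks b (Suc i) x' x' x = s (Suc i)" for i
    by (auto simp: s_def splice_blocks_def vec_eq_iff)
  have "?L (s m) + ereal (\<Sum>i=1..m. ?d i) \<le> ?L (s 0)" if "m \<le> n" for m
    using that
  proof (induction m)
    case 0
    then show ?case by (simp add: zero_ereal_def[symmetric])
  next
    case (Suc m)
    have "?L (s (Suc m)) + ereal (\<Sum>i=1..Suc m. ?d i)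
        = (?L (s (Suc m)) + ereal (?d (Suc m))) + ereal (\<Sum>i=1..m. ?d i)"
      by (cases "?L (s (Suc m))") simp_all
    also have "\<dots> \<le> ?L (s m) + ereal (\<Sum>i=1..m. ?d i)"
      using block_step_descent[OF assms(1,2) _ min, of "Suc m" x] Suc.prems
      by (intro add_right_mono) (simp add: before after)
    also have "\<dots> \<le> ?L (s 0)"
      using Suc by simp
    finally show ?case .
  qed
  from this[of n] show ?thesis
    by (simp add: \<open>s 0 = x\<close> \<open>s n = x'\<close> sum_distrib_left)
qed

lemma slack_step_descent:
  assumes "convex_on UNIV h"
    and min: "finite_minimizer (\<lambda>w. aug_lagrangian n b A f h \<rho> x w y) z'"
  shows "aug_lagrangian n b A f h \<rho> x z' y + ereal (\<rho> / 2 * (norm (z' - z))\<^sup>2)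
    \<le> aug_lagrangian n b A f h \<rho> x z y"
proof -
  let ?R = "residual n b A x"
  obtain F where F: "f x = ereal F"
    using min by (cases "f x") (auto simp: finite_minimizer_def aug_lagrangian_def)
  have "?R ((1 - t) *\<^sub>R z' + t *\<^sub>R z) = (1 - t) *\<^sub>R ?R z' + t *\<^sub>R ?R z" for t
    by (simp add: residual_def algebra_simps)
  moreover have "finite_minimizer
      (\<lambda>w. ereal (h w) + ereal (F + y \<bullet> ?R w + \<rho> / 2 * (norm (?R w))\<^sup>2)) z'"
    using min by (simp add: aug_lagrangian_def F algebra_simps)
  ultimately have "ereal (h z') + ereal (F + y \<bullet> ?R z' + \<rho> / 2 * (norm (?R z'))\<^sup>2)
      + ereal (\<rho> / 2 * (norm (?R z - ?R z'))\<^sup>2)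
    \<le> ereal (h z) + ereal (F + y \<bullet> ?R z + \<rho> / 2 * (norm (?R z))\<^sup>2)"
    by (intro minimizer_quadratic_growth convex_ereal_real assms(1))
  moreover have "?R z - ?R z' = z' - z"
    by (simp add: residual_def)
  ultimately show ?thesis
    by (simp add: aug_lagrangian_def F algebra_simps)
qed

text \<open>
  The right-hand side is the updated multiplier, so after every iteration the multiplier is the
  gradient of \<open>h\<close> at the new slack variable. This is what makes changes of \<open>y\<close> controllable by
  changes of \<open>z\<close>.
\<close>

lemma slack_step_optimality:
  assumes grad: "GDERIV h z' :> D"
    and min: "finite_minimizer (\<lambda>w. aug_lagrangian n b A f h \<rho> x w y) z'"
  shows "D = y + \<rho> *\<^sub>R residual n b A x z'"
proof -
  let ?R = "residual n b A x"
  define \<psi> where "\<psi> w = h w + y \<bullet> ?R w + \<rho> / 2 * (?R w \<bullet> ?R w)" for w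
  obtain F where F: "f x = ereal F"
    using min by (cases "f x") (auto simp: finite_minimizer_def aug_lagrangian_def)
  have le: "\<psi> z' \<le> \<psi> w" for w
    using min by (simp add: finite_minimizer_def aug_lagrangian_def F \<psi>_def power2_norm_eq_inner)
  let ?g = "D - (y + \<rho> *\<^sub>R ?R z')"
  have R: "(?R has_derivative uminus) (at z')"
    unfolding residual_def by (auto intro!: derivative_eq_intros)
  have "(\<psi> has_derivative (\<lambda>d. d \<bullet> ?g)) (at z')"
    unfolding \<psi>_def
    by (rule derivative_eq_intros grad[unfolded gderiv_def] R refl)+
       (auto simp: fun_eq_iff algebra_simps inner_commute)
  then have "(\<lambda>d. d \<bullet> ?g) = (\<lambda>d. 0)"
    using le by (intro differential_zero_maxmin[of z' UNIV \<psi>]) auto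
  then have "?g \<bullet> ?g = 0"
    by (rule fun_cong)
  then show ?thesis
    by simp
qed

lemma dual_step_ascent:
  assumes "y' = y + \<rho> *\<^sub>R residual n b A x z" and "\<rho> > 0"
  shows "aug_lagrangian n b A f h \<rho> x z y'
    = aug_lagrangian n b A f h \<rho> x z y + ereal ((norm (y' - y))\<^sup>2 / \<rho>)"
proof -
  let ?r = "residual n b A x z"
  have "(norm (y' - y))\<^sup>2 / \<rho> = \<rho> * (?r \<bullet> ?r)"
    using assms by (simp add: power_mult_distrib power2_eq_square[of \<rho>] flip: power2_norm_eq_inner)
  moreover have "y' \<bullet> ?r = y \<bullet> ?r + \<rho> * (?r \<bullet> ?r)"
    using assms by (simp add: inner_add_left)
  ultimately show ?thesis
    by (simp add: aug_lagrangian_def add.assoc algebra_simps)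
qed

text \<open>
  The multiplier must be \<open>grad_h z\<close>: then the inner product in the Lagrangian is the first-order term
  of \<open>h\<close> at \<open>z\<close>, and the penalty absorbs the remainder when passing to the feasible point
  \<open>(x, A *v x)\<close>.
\<close>

lemma aug_lagrangian_lower_bound:
  assumes "block_decomposition n b" and "convex_on UNIV h" and "\<And>w. GDERIV h w :> grad_h w"
    and "H-lipschitz_on UNIV grad_h" and "\<rho> \<ge> 2 * H"
    and feasible: "\<And>x z. residual n b A x z = 0 \<Longrightarrow> ereal m \<le> f x + ereal (h z)"
  shows "ereal m \<le> aug_lagrangian n b A f h \<rho> x z (grad_h z)"
proof -
  let ?r = "residual n b A x z"
  have r: "?r = A *v x - z"
    by (rule residual_eq[OF assms(1)])
  have "h (A *v x) \<le> h z + grad_h z \<bullet> ?r + H * (norm ?r)\<^sup>2"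
    unfolding r using convex_lipschitz_gradient_upper_bound[OF assms(2-4)] .
  also have "H * (norm ?r)\<^sup>2 \<le> \<rho> / 2 * (norm ?r)\<^sup>2"
    using assms(5) by (intro mult_right_mono) auto
  finally have h: "h (A *v x) \<le> h z + grad_h z \<bullet> ?r + \<rho> / 2 * (norm ?r)\<^sup>2"
    by simp
  have "ereal m \<le> f x + ereal (h (A *v x))"
    by (rule feasible) (simp add: residual_eq[OF assms(1)])
  also have "\<dots> \<le> aug_lagrangian n b A f h \<rho> x z (grad_h z)"
    unfolding aug_lagrangian_def using h by (intro add_left_mono) simp
  finally show ?thesis .
qed

section \<open>The rate\<close>

theorem theorem3:
  fixes n :: nat
    and b :: "'p::finite \<Rightarrow> nat"
    and A :: "real ^ 'p ^ 'q"
    and f :: "real ^ 'p \<Rightarrow> ereal"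
    and h :: "real ^ 'q \<Rightarrow> real"
    and grad_h :: "real ^ 'q \<Rightarrow> real ^ 'q"
    and H \<rho> :: real
    and x :: "nat \<Rightarrow> real ^ 'p"
    and z y :: "nat \<Rightarrow> real ^ 'q"
    and u :: "nat \<Rightarrow> real"
  assumes "block_decomposition n b"
    and "proper f"
    and "continuous_on UNIV f"
    and "multi_convex n b f"
    and "convex_on UNIV h"
    and "\<And>w. GDERIV h w :> grad_h w"
    and "H-lipschitz_on UNIV grad_h"
    and "bounded_below_on_feasible n b A f h"
    and "\<rho> > 0"
    and "\<rho> > 2 * H"
    and "admm_sequence n b A f h \<rho> x z y"
    and "bounded (range (\<lambda>k. (x k, z k, y k)))"
    and "\<And>k. u k = Min ((\<lambda>l. (norm (z (Suc l) - z l))\<^sup>2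
                 + (\<Sum>i=1..n. (norm (block_mult A b i (x (Suc l) - x l)))\<^sup>2)) ` {0..k})"
  shows "u \<in> o(\<lambda>k. 1 / real k)"
proof -
  define a where "a l = (norm (z (Suc l) - z l))\<^sup>2
      + (\<Sum>i=1..n. (norm (block_mult A b i (x (Suc l) - x l)))\<^sup>2)" for l
  let ?L = "aug_lagrangian n b A f h \<rho>"
  define E where "E k = real_of_ereal (?L (x k) (z k) (y k))" for k
  define c where "c = \<rho> / 2 - H\<^sup>2 / \<rho>"
  note rho = \<open>\<rho> > 0\<close> \<open>\<rho> > 2 * H\<close>
  have "H \<ge> 0"
    using \<open>H-lipschitz_on UNIV grad_h\<close> by (rule lipschitz_on_nonneg)
  have "c > 0"
  proof -
    have "(2 * H)\<^sup>2 < \<rho>\<^sup>2"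
      using rho \<open>H \<ge> 0\<close> by (intro power_strict_mono) auto
    then have "H\<^sup>2 * 2 < \<rho> * \<rho>"
      using zero_le_square[of H] unfolding power_mult_distrib power2_eq_square by linarith
    then show ?thesis
      using rho by (simp add: c_def field_simps power2_eq_square)
  qed
  have x_min: "finite_minimizer (\<lambda>v. ?L (splice_blocks b i (x (Suc k)) v (x k)) (z k) (y k)) (x (Suc k))"
    if "i \<in> {1..n}" for i k
    using \<open>admm_sequence n b A f h \<rho> x z y\<close> that by (simp add: admm_sequence_def)
  have z_min: "finite_minimizer (\<lambda>w. ?L (x (Suc k)) w (y k)) (z (Suc k))"
    and y_step: "y (Suc k) = y k + \<rho> *\<^sub>R residual n b A (x (Suc k)) (z (Suc k))" for k
    using \<open>admm_sequence n b A f h \<rho> x z y\<close> by (simp_all add: admm_sequence_def)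
  have y_eq: "y k = grad_h (z k)" if "k \<ge> 1" for k
    using that slack_step_optimality[OF assms(6) z_min] y_step by (cases k) auto
  have L_finite: "\<exists>e. ?L (x k) z' y' = ereal e" if "k \<ge> 1" for k z' y'
  proof -
    obtain k' where k': "k = Suc k'"
      using \<open>k \<ge> 1\<close> by (cases k) auto
    have "\<bar>f (x k)\<bar> \<noteq> \<infinity>"
      using z_min[of k'] unfolding k'
      by (cases "f (x (Suc k'))") (auto simp: finite_minimizer_def aug_lagrangian_def)
    then show ?thesis
      by (cases "f (x k)") (auto simp: aug_lagrangian_def)
  qed
  obtain m where m: "\<And>x z. residual n b A x z = 0 \<Longrightarrow> ereal m \<le> f x + ereal (h z)"
    using assms(8) by (auto simp: bounded_below_on_feasible_def)
  have lower: "m \<le> E k" if "k \<ge> 1" for k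
  proof -
    have "2 * H \<le> \<rho>"
      using rho by simp
    then have "ereal m \<le> ?L (x k) (z k) (grad_h (z k))"
      by (rule aug_lagrangian_lower_bound[OF assms(1,5,6,7)]) (rule m)
    then show ?thesis
      using L_finite[OF that, of "z k" "y k"] by (auto simp: E_def y_eq[OF that])
  qed
  have descent: "E (Suc k) + c * a k \<le> E k" if "k \<ge> 1" for k
  proof -
    let ?dx = "\<Sum>i=1..n. (norm (block_mult A b i (x (Suc k) - x k)))\<^sup>2"
    let ?dz = "(norm (z (Suc k) - z k))\<^sup>2"
    obtain e0 e1 e2 where e: "?L (x k) (z k) (y k) = ereal e0"
      "?L (x (Suc k)) (z k) (y k) = ereal e1" "?L (x (Suc k)) (z (Suc k)) (y k) = ereal e2"
      using L_finite[OF \<open>k \<ge> 1\<close>] L_finite[of "Suc k"] by (metis One_nat_def le_add1 plus_1_eq_Suc)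
    have "e1 + \<rho> / 2 * ?dx \<le> e0"
      using block_sweep_descent[OF assms(1,4) x_min[where k = k]] by (simp add: e)
    moreover have "e2 + \<rho> / 2 * ?dz \<le> e1"
      using slack_step_descent[OF assms(5) z_min[of k], of "z k"] by (simp add: e)
    moreover have "E (Suc k) = e2 + (norm (y (Suc k) - y k))\<^sup>2 / \<rho>"
      using dual_step_ascent[OF y_step rho(1), of f h k] by (simp add: E_def e)
    moreover have "(norm (y (Suc k) - y k))\<^sup>2 / \<rho> \<le> H\<^sup>2 / \<rho> * ?dz"
    proof -
      have "norm (y (Suc k) - y k) \<le> H * norm (z (Suc k) - z k)"
        using lipschitz_onD[OF assms(7), of "z (Suc k)" "z k"] that
        by (simp add: y_eq dist_norm)
      then have "(norm (y (Suc k) - y k))\<^sup>2 \<le> H\<^sup>2 * ?dz"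
        by (metis norm_ge_zero power_mono power_mult_distrib)
      then show ?thesis
        using rho by (simp add: divide_right_mono)
    qed
    moreover have "c * ?dx \<le> \<rho> / 2 * ?dx"
      using rho by (intro mult_right_mono sum_nonneg) (auto simp: c_def)
    moreover have "E k = e0"
      by (simp add: E_def e)
    ultimately show ?thesis
      by (simp add: a_def c_def algebra_simps)
  qed
  have nonneg: "a l \<ge> 0" for l
    by (simp add: a_def sum_nonneg)
  show ?thesis
  proof (rule running_Min_smallo)
    show "summable a"
      using nonneg \<open>c > 0\<close> descent lower by (rule summable_of_descent)
    show "u k = Min (a ` {0..k})" for k
      unfolding assms(13) a_def ..
  qed (rule nonneg)
qed

end
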